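(* Let $n=p^m$, where $p$ is a prime and $m\geq 2$ is an integer. Then $\alpha\bigl(\Theta(\mathbb{Z}_n)\bigr)=n-p$.
   Context: $\mathbb{Z}_n$ denotes the cyclic group of order $n$. For a finite group $G$, $|g|$ denotes the order of $g\in G$, and the prime-coprime graph $\Theta(G)$ is the simple graph with vertex set $G$ in which two distinct vertices $g,h$ are adjacent if and only if $\gcd(|g|,|h|)$ is either $1$ or a prime. The independence number $\alpha(\Gamma)$ of a graph $\Gamma$ is the maximum cardinality of an independent set of $\Gamma$. *)

theory Defs
  imports
    "HOL-Algebra.Elementary_Groups"
    "HOL-Algebra.Multiplicative_Group"
    "HOL-Computational_Algebra.Primes"
    "Graph_Theory.Pair_Digraph"
begin

text \<open>
  Simple graphs are loop-free symmetric digraphs without parallel arcs, that is, elements of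
  the locale \<^locale>\<open>pair_graph\<close>: an edge is represented by its two orientations.
\<close>

definition prime_coprime_graph :: "('a, 'b) monoid_scheme \<Rightarrow> 'a pair_pre_digraph" where
  "prime_coprime_graph G =
    \<lparr> pverts = carrier G,
      parcs = {(g, h). g \<in> carrier G \<and> h \<in> carrier G \<and> g \<noteq> h \<and>
        (gcd (group.ord G g) (group.ord G h) = 1 \<or> prime (gcd (group.ord G g) (group.ord G h)))} \<rparr>"

lemma pair_graph_prime_coprime_graph:
  assumes "finite (carrier G)"
  shows "pair_graph (prime_coprime_graph G)"
proof
  show "finite (parcs (prime_coprime_graph G))"
    by (rule finite_subset[of _ "carrier G \<times> carrier G"])
       (auto simp: prime_coprime_graph_def assms)
qed (auto simp: prime_coprime_graph_def assms symmetric_def sym_def gcd.commute)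

definition independent_set :: "('a, 'b) pre_digraph \<Rightarrow> 'a set \<Rightarrow> bool" where
  "independent_set \<Gamma> S \<longleftrightarrow>
    S \<subseteq> verts \<Gamma> \<and> (\<forall>u\<in>S. \<forall>v\<in>S. u \<noteq> v \<longrightarrow> (u, v) \<notin> arcs_ends \<Gamma>)"

text \<open>
  Meaningful for graphs with finitely many vertices, where the maximum is over a finite set
  that is nonempty because the empty set is independent.
\<close>

definition independence_number :: "('a, 'b) pre_digraph \<Rightarrow> nat" where
  "independence_number \<Gamma> = Max (card ` {S. independent_set \<Gamma> S})"

end

(* In a cyclic p-group the gcd of two element orders is the smaller of the two, so two elements are
   adjacent exactly when one of them has order dividing p. The p elements of such order are joined
   to every other vertex, hence lie in no independent set with a second vertex, while the other
   n - p vertices form an independent set. *)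

theory Submission
  imports Defs
begin

text \<open>An independent set that avoids \<open>D\<close> lies in the complement of
  \<open>D\<close>, which is itself independent. One that contains some d in \<open>D\<close> is
  just {d}, because d is adjacent to every other vertex.\<close>

lemma independence_number_dominating:
  assumes "finite (verts \<Gamma>)" and "D \<subseteq> verts \<Gamma>" and "verts \<Gamma> - D \<noteq> {}"
    and adj: "\<And>u v. \<lbrakk>u \<in> verts \<Gamma>; v \<in> verts \<Gamma>; u \<noteq> v\<rbrakk> \<Longrightarrow>
      (u, v) \<in> arcs_ends \<Gamma> \<longleftrightarrow> u \<in> D \<or> v \<in> D"
  shows "independence_number \<Gamma> = card (verts \<Gamma>) - card D"
proof -
  have "Max (card ` {S. independent_set \<Gamma> S}) = card (verts \<Gamma> - D)"
  proof (rule Max_eqI)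
    have "{S. independent_set \<Gamma> S} \<subseteq> Pow (verts \<Gamma>)"
      by (auto simp: independent_set_def)
    then show "finite (card ` {S. independent_set \<Gamma> S})"
      using assms(1) by (meson finite_Pow_iff finite_imageI finite_subset)
  next
    have "independent_set \<Gamma> (verts \<Gamma> - D)"
      using adj by (auto simp: independent_set_def)
    then show "card (verts \<Gamma> - D) \<in> card ` {S. independent_set \<Gamma> S}"
      by blast
  next
    fix k assume "k \<in> card ` {S. independent_set \<Gamma> S}"
    then obtain S where S: "independent_set \<Gamma> S" and k: "k = card S"
      by blast
    have sub: "S \<subseteq> verts \<Gamma>"
      using S by (simp add: independent_set_def)
    show "k \<le> card (verts \<Gamma> - D)"
    proof (cases "S \<inter> D = {}")
      case True
      then have "S \<subseteq> verts \<Gamma> - D"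
        using sub by blast
      then show ?thesis
        using assms(1) k by (simp add: card_mono)
    next
      case False
      then obtain d where d: "d \<in> S" "d \<in> D"
        by blast
      have "S \<subseteq> {d}"
      proof
        fix v assume v: "v \<in> S"
        then have "v \<noteq> d \<longrightarrow> (d, v) \<notin> arcs_ends \<Gamma>"
          using S d by (auto simp: independent_set_def)
        then show "v \<in> {d}"
          using adj[of d v] sub d v by blast
      qed
      then have "k \<le> 1"
        using k card_mono[of "{d}" S] by simp
      \<comment> \<open>Nonemptiness of the complement enters here: without it a singleton inside
        \<open>D\<close> would be the larger independent set.\<close>
      also have "1 \<le> card (verts \<Gamma> - D)"
        using assms(1,3) by (simp add: Suc_le_eq card_gt_0_iff)
      finally show ?thesis .
    qed
  qed
  then show ?thesis
    using assms(1,2) by (simp add: independence_number_def card_Diff_subset finite_subset)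
qed

text \<open>Writing a = p^i and b = p^j gives gcd p^(min i j). A power of p is 1 or prime exactly
  when its exponent is 0 or 1, and min i j \<le> 1 means that i \<le> 1 or j \<le> 1.\<close>

lemma gcd_primepow_eq_1_or_prime_iff:
  fixes p a b :: nat
  assumes p: "prime p" and "a dvd p ^ m" and "b dvd p ^ m"
  shows "gcd a b = 1 \<or> prime (gcd a b) \<longleftrightarrow> a dvd p \<or> b dvd p"
proof -
  obtain i j where ij: "a = p ^ i" "b = p ^ j"
    using assms by (auto simp: divides_primepow_nat)
  have dvd_iff: "p ^ k dvd p \<longleftrightarrow> k \<le> 1" for k
    using prime_gt_1_nat[OF p] by (metis dvd_power_iff_le power_one_right prime_ge_2_nat p)
  have *: "p ^ k = 1 \<or> prime (p ^ k) \<longleftrightarrow> k \<le> 1" for k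
    using p prime_gt_1_nat[OF p] by (auto simp: prime_power_iff)
  have "gcd a b = p ^ min i j"
    unfolding ij by (cases "i \<le> j") (auto simp: min_def le_imp_power_dvd gcd_proj1_if_dvd gcd_proj2_if_dvd)
  then show ?thesis
    unfolding ij dvd_iff by (simp only: *) (simp add: min_le_iff_disj)
qed

text \<open>The order of x divides d iff d * x is 0 modulo d * e, that is, iff e divides x. The
  multiples of e in [0, d * e) are e * i for i < d.\<close>

lemma card_torsion_integer_mod_group:
  assumes "d > 0" and "e > 0"
  shows "card {x \<in> carrier (integer_mod_group (d * e)). group.ord (integer_mod_group (d * e)) x dvd d} = d"
proof -
  let ?G = "integer_mod_group (d * e)"
  interpret group ?G
    by simp
  have "ord x dvd d \<longleftrightarrow> int e dvd x" if "x \<in> carrier ?G" for x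
    using pow_eq_id[OF that, of d] assms by (simp flip: dvd_eq_mod_eq_0)
  then have "{x \<in> carrier ?G. ord x dvd d} = {x \<in> {0..<int (d * e)}. int e dvd x}"
    using assms by (auto simp: carrier_integer_mod_group)
  also have "\<dots> = (\<lambda>i. int e * int i) ` {..<d}"
  proof (intro equalityI subsetI)
    fix x assume x: "x \<in> {x \<in> {0..<int (d * e)}. int e dvd x}"
    then obtain y where y: "x = int e * y"
      by (auto elim: dvdE)
    with x assms have "0 \<le> y" "y < int d"
      by (auto simp: zero_le_mult_iff mult.commute[of "int d"])
    then have "nat y < d" "x = int e * int (nat y)"
      using y by auto
    then show "x \<in> (\<lambda>i. int e * int i) ` {..<d}"
      by blast
  next
    fix x assume "x \<in> (\<lambda>i. int e * int i) ` {..<d}"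
    then show "x \<in> {x \<in> {0..<int (d * e)}. int e dvd x}"
      using assms by (auto simp: mult.commute[of "int d"])
  qed
  also have "card \<dots> = d"
    using assms by (subst card_image) (auto simp: inj_on_def)
  finally show ?thesis .
qed

theorem corollary3p11:
  fixes n p m :: nat
  assumes "prime p"
    and "m \<ge> 2"
    and "n = p ^ m"
  shows "independence_number (with_proj (prime_coprime_graph (integer_mod_group n))) = n - p"
proof -
  let ?G = "integer_mod_group n"
  let ?\<Gamma> = "with_proj (prime_coprime_graph ?G)"
  interpret group ?G
    by simp
  define D where "D = {x \<in> carrier ?G. ord x dvd p}"
  have p: "p > 1"
    using assms(1) by (rule prime_gt_1_nat)
  have carrier: "carrier ?G = {0..<int n}"
    using p assms(3) by (simp add: carrier_integer_mod_group)
  have verts: "pverts (prime_coprime_graph ?G) = carrier ?G"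
    by (simp add: prime_coprime_graph_def)
  \<comment> \<open>This factorization lets the torsion count apply with d = p and e = p^(m -
    1).\<close>
  have "n = p * p ^ (m - 1)"
    using assms(2,3) by (simp flip: power_Suc)
  then have cardD: "card D = p"
    unfolding D_def using card_torsion_integer_mod_group[of p "p ^ (m - 1)"] p by simp
  \<comment> \<open>By Lagrange, every element order divides the group order n; this makes the gcd
    criterion applicable.\<close>
  have ord_dvd: "ord x dvd p ^ m" if "x \<in> carrier ?G" for x
    using ord_dvd_group_order[OF that] by (simp add: order_def carrier flip: assms(3))
  \<comment> \<open>This is where m \<ge> 2 matters: for m = 1 the set \<open>D\<close> would be the
    whole group.\<close>
  have "p < n"
    using power_strict_increasing[of 1 m p] p assms(2,3) by simp
  then have "card D < card (carrier ?G)"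
    by (simp add: cardD carrier)
  \<comment> \<open>Otherwise the carrier would lie in \<open>D\<close>, which is finite because its
    cardinality p is positive, against the strict inequality of cardinalities.\<close>
  then have "carrier ?G - D \<noteq> {}"
    using card_mono[of D "carrier ?G"] card_ge_0_finite[of D] p cardD by auto
  then have "independence_number ?\<Gamma> = card (verts ?\<Gamma>) - card D"
  proof (intro independence_number_dominating)
    fix u v assume "u \<in> verts ?\<Gamma>" "v \<in> verts ?\<Gamma>" "u \<noteq> v"
    then show "(u, v) \<in> arcs_ends ?\<Gamma> \<longleftrightarrow> u \<in> D \<or> v \<in> D"
      using gcd_primepow_eq_1_or_prime_iff[OF assms(1) ord_dvd ord_dvd, of u v]
      by (simp add: D_def prime_coprime_graph_def)
  qed (auto simp: verts carrier D_def)
  then show ?thesis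
    by (simp add: verts cardD carrier)
qed

end
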